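(* Let $S$ be a non-periodic inverse semigroup which is a HS. Then $S$ is a group (which is homogeneous as a semigroup).
   Context: All structures are countable. A semigroup $S$ is a HS (homogeneous semigroup) if every isomorphism between finitely generated subsemigroups of $S$ extends to an automorphism of $S$. The order of an element $a$ of an inverse semigroup $S$ is the cardinality of the inverse subsemigroup generated by $a$; $S$ is periodic if every element has finite order, and non-periodic otherwise. *)

theory Defs
  imports "HOL-Algebra.Group" "HOL-Library.Countable_Set"
begin

text \<open>
  Semigroups are carried by the \<^typ>\<open>('a, 'm) monoid_scheme\<close> records of HOL-Algebra, so that
  \<^const>\<open>hom\<close> and \<^const>\<open>iso\<close>, which only look at the fields \<^term>\<open>carrier\<close> and \<^term>\<open>mult\<close>, are
  available. The field \<^term>\<open>one\<close> is unconstrained and is never used by the notions below.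
\<close>

locale alg_semigroup =
  fixes S :: "('a, 'm) monoid_scheme" (structure)
  assumes m_closed: "\<lbrakk>x \<in> carrier S; y \<in> carrier S\<rbrakk> \<Longrightarrow> x \<otimes> y \<in> carrier S"
    and m_assoc: "\<lbrakk>x \<in> carrier S; y \<in> carrier S; z \<in> carrier S\<rbrakk>
      \<Longrightarrow> (x \<otimes> y) \<otimes> z = x \<otimes> (y \<otimes> z)"

inductive_set gen_subsemigroup :: "('a, 'm) monoid_scheme \<Rightarrow> 'a set \<Rightarrow> 'a set"
  for S and A where
    incl: "a \<in> A \<Longrightarrow> a \<in> gen_subsemigroup S A"
  | mult: "\<lbrakk>x \<in> gen_subsemigroup S A; y \<in> gen_subsemigroup S A\<rbrakk>
      \<Longrightarrow> x \<otimes>\<^bsub>S\<^esub> y \<in> gen_subsemigroup S A"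

definition fg_subsemigroup :: "('a, 'm) monoid_scheme \<Rightarrow> 'a set \<Rightarrow> bool" where
  "fg_subsemigroup S T \<longleftrightarrow>
     (\<exists>A. finite A \<and> A \<noteq> {} \<and> A \<subseteq> carrier S \<and> T = gen_subsemigroup S A)"

locale homogeneous_semigroup = alg_semigroup +
  assumes extend_iso:
    "\<lbrakk>fg_subsemigroup S T; fg_subsemigroup S U;
      \<phi> \<in> iso (S\<lparr>carrier := T\<rparr>) (S\<lparr>carrier := U\<rparr>)\<rbrakk>
     \<Longrightarrow> \<exists>\<psi> \<in> iso S S. \<forall>x \<in> T. \<psi> x = \<phi> x"

definition semigroup_inverse :: "('a, 'm) monoid_scheme \<Rightarrow> 'a \<Rightarrow> 'a \<Rightarrow> bool" where
  "semigroup_inverse S x y \<longleftrightarrow>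
     y \<in> carrier S \<and> x \<otimes>\<^bsub>S\<^esub> y \<otimes>\<^bsub>S\<^esub> x = x \<and> y \<otimes>\<^bsub>S\<^esub> x \<otimes>\<^bsub>S\<^esub> y = y"

locale inverse_semigroup = alg_semigroup +
  assumes unique_inverse: "x \<in> carrier S \<Longrightarrow> \<exists>!y. semigroup_inverse S x y"

text \<open>
  Not to be confused with \<^const>\<open>m_inv\<close>, which refers to the field \<^term>\<open>one\<close>. It is meaningful
  only for elements of inverse semigroups.
\<close>

definition s_inv :: "('a, 'm) monoid_scheme \<Rightarrow> 'a \<Rightarrow> 'a" where
  "s_inv S x = (THE y. semigroup_inverse S x y)"

inductive_set gen_inverse_subsemigroup :: "('a, 'm) monoid_scheme \<Rightarrow> 'a set \<Rightarrow> 'a set"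
  for S and A where
    incl: "a \<in> A \<Longrightarrow> a \<in> gen_inverse_subsemigroup S A"
  | mult: "\<lbrakk>x \<in> gen_inverse_subsemigroup S A; y \<in> gen_inverse_subsemigroup S A\<rbrakk>
      \<Longrightarrow> x \<otimes>\<^bsub>S\<^esub> y \<in> gen_inverse_subsemigroup S A"
  | inv: "x \<in> gen_inverse_subsemigroup S A \<Longrightarrow> s_inv S x \<in> gen_inverse_subsemigroup S A"

definition finite_order :: "('a, 'm) monoid_scheme \<Rightarrow> 'a \<Rightarrow> bool" where
  "finite_order S a \<longleftrightarrow> finite (gen_inverse_subsemigroup S {a})"

definition periodic :: "('a, 'm) monoid_scheme \<Rightarrow> bool" where
  "periodic S \<longleftrightarrow> (\<forall>a \<in> carrier S. finite_order S a)"

end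

(* If the powers of a are distinct, e = a a^-1, and g is an idempotent with g a = a, then the
   subsemigroup {g, a^n, a^n g} is determined up to isomorphism by the set of n with a^n g = a^n.
   If g and e give the same set, homogeneity provides an automorphism fixing a, hence e, and mapping
   g to e, so g = e.

   A non-periodic S contains an a with distinct powers. If a^n e = a^n for some n >= 1, then b = a^n
   satisfies b b b^-1 = b. Otherwise put f = a^-1 a; the criterion applied to c = f a and g = e gives
   e = c c^-1 = e f, and b = a^-1 satisfies b b b^-1 = b. Now b b^-1 is a two-sided unit for b, and the
   criterion shows that it is a maximal idempotent. As the automorphisms act transitively on the
   idempotents, all idempotents are maximal, so there is only one and S is a group. *)

theory Submission
  imports Defs
begin

section \<open>Powers in a semigroup\<close>

text \<open>The index is shifted, since there is no identity: \<open>spow S x n\<close> is the power with exponent \<open>n + 1\<close>.\<close>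

primrec spow :: "('a, 'm) monoid_scheme \<Rightarrow> 'a \<Rightarrow> nat \<Rightarrow> 'a" where
  "spow S x 0 = x"
| "spow S x (Suc n) = x \<otimes>\<^bsub>S\<^esub> spow S x n"

context alg_semigroup
begin

lemma spow_closed [simp]: "x \<in> carrier S \<Longrightarrow> spow S x n \<in> carrier S"
  by (induction n) (auto simp: m_closed)

lemma spow_mult:
  "x \<in> carrier S \<Longrightarrow> spow S x m \<otimes> spow S x n = spow S x (Suc (m + n))"
  by (induction m) (auto simp: m_assoc)

lemma spow_Suc_right: "x \<in> carrier S \<Longrightarrow> spow S x (Suc n) = spow S x n \<otimes> x"
  using spow_mult[of x n 0] by simp

text \<open>In terms of exponents this is (n + 1)(m + 1) = (n + m(n + 1)) + 1.\<close>

lemma spow_spow: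
  "x \<in> carrier S \<Longrightarrow> spow S (spow S x n) m = spow S x (n + m * Suc n)"
  by (induction m) (auto simp: spow_mult add_ac)

lemma inj_spow_spow:
  assumes "x \<in> carrier S" "inj (spow S x)"
  shows "inj (spow S (spow S x n))"
proof (rule injI)
  fix k m assume "spow S (spow S x n) k = spow S (spow S x n) m"
  then have "n + k * Suc n = n + m * Suc n"
    using assms by (simp only: spow_spow inj_eq)
  then show "k = m" by (metis add_left_cancel mult_cancel2 nat.distinct(1))
qed

lemma left_unit_spow:
  assumes "g \<in> carrier S" "x \<in> carrier S" "g \<otimes> x = x"
  shows "g \<otimes> spow S x n = spow S x n"
  using assms by (cases n) (auto simp: m_assoc[symmetric])

lemma right_unit_spow:
  assumes "g \<in> carrier S" "x \<in> carrier S" "x \<otimes> g = x"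
  shows "spow S x n \<otimes> g = spow S x n"
  using assms by (cases n) (auto simp: m_assoc spow_Suc_right simp del: spow.simps(2))

text \<open>Iterating a translation zero times stands in for the missing power with exponent 0. This
  lemma and \<open>funpow_mult_right\<close> lead back to genuine powers when the exponent is
  positive.\<close>

lemma funpow_mult_left:
  assumes "x \<in> carrier S" "y \<in> carrier S"
  shows "((\<otimes>) x ^^ Suc n) y = spow S x n \<otimes> y"
  using assms by (induction n) (auto simp: m_assoc)

lemma funpow_mult_right:
  assumes "x \<in> carrier S" "y \<in> carrier S"
  shows "((\<lambda>z. z \<otimes> x) ^^ Suc n) y = y \<otimes> spow S x n"
proof (induction n)
  case (Suc n)
  then have "((\<lambda>z. z \<otimes> x) ^^ Suc (Suc n)) y = y \<otimes> spow S x n \<otimes> x" by simp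
  then show ?case using assms by (simp add: m_assoc spow_Suc_right del: spow.simps(2))
qed simp

text \<open>If the powers at indices p < q agree, an index n \<ge> q can be lowered to p + (n - q)
  without changing the power, so indices below q already give all powers.\<close>

lemma finite_range_spow:
  assumes x: "x \<in> carrier S" and "\<not> inj (spow S x)"
  shows "finite (range (spow S x))"
proof -
  obtain p q where pq: "p < q" "spow S x p = spow S x q"
    using assms(2) by (metis injI linorder_neqE_nat)
  have "spow S x n \<in> spow S x ` {..<q}" for n
  proof (induction n rule: less_induct)
    case (less n)
    show ?case
    proof (cases "n < q")
      case False
      have "spow S x n = spow S x (p + (n - q))"
      \<comment> \<open>For n = q the factor to be split off would have exponent 0, hence the
        separate case.\<close>
      proof (cases "n = q")
        case True then show ?thesis using pq by simp
      next
        case nq: False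
        then have "n = Suc (q + (n - q - 1))" "p + (n - q) = Suc (p + (n - q - 1))"
          using False by auto
        then show ?thesis using pq spow_mult[OF x] by metis
      qed
      moreover have "p + (n - q) < n" using False pq by auto
      ultimately show ?thesis using less by metis
    qed auto
  qed
  then show ?thesis by (meson finite_imageI finite_lessThan finite_subset image_subset_iff)
qed

end

section \<open>Inverses and commuting idempotents\<close>

context inverse_semigroup
begin

abbreviation sinv :: "'a \<Rightarrow> 'a" ("_\<^sup>\<star>" [1000] 1000) where
  "x\<^sup>\<star> \<equiv> s_inv S x"

lemma s_inv_semigroup_inverse: "x \<in> carrier S \<Longrightarrow> semigroup_inverse S x (x\<^sup>\<star>)"
  unfolding s_inv_def by (rule theI') (rule unique_inverse)

lemma s_inv_eqI:
  assumes "x \<in> carrier S" "y \<in> carrier S" "x \<otimes> y \<otimes> x = x" "y \<otimes> x \<otimes> y = y"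
  shows "x\<^sup>\<star> = y"
  using assms unique_inverse s_inv_semigroup_inverse unfolding semigroup_inverse_def by metis

lemma s_inv_closed [simp]: "x \<in> carrier S \<Longrightarrow> x\<^sup>\<star> \<in> carrier S"
  using s_inv_semigroup_inverse unfolding semigroup_inverse_def by blast

lemma mult_s_inv_mult:
  assumes "x \<in> carrier S"
  shows "x \<otimes> (x\<^sup>\<star> \<otimes> x) = x" "x\<^sup>\<star> \<otimes> (x \<otimes> x\<^sup>\<star>) = x\<^sup>\<star>"
  using assms s_inv_semigroup_inverse[of x] unfolding semigroup_inverse_def
  by (auto simp: m_assoc)

text \<open>Cancellation in front of a further factor, the form that arises once
  \<open>m_assoc\<close> has moved all brackets to the right.\<close>

lemma mult_s_inv_mult_assoc:
  assumes "x \<in> carrier S" "z \<in> carrier S"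
  shows "x \<otimes> (x\<^sup>\<star> \<otimes> (x \<otimes> z)) = x \<otimes> z" "x\<^sup>\<star> \<otimes> (x \<otimes> (x\<^sup>\<star> \<otimes> z)) = x\<^sup>\<star> \<otimes> z"
  using assms mult_s_inv_mult[of x] by (auto simp: m_assoc[symmetric] m_closed)

lemma s_inv_s_inv [simp]: "x \<in> carrier S \<Longrightarrow> x\<^sup>\<star>\<^sup>\<star> = x"
  by (rule s_inv_eqI) (auto simp: m_assoc mult_s_inv_mult m_closed)

lemma s_inv_idem: "e \<in> carrier S \<Longrightarrow> e \<otimes> e = e \<Longrightarrow> e\<^sup>\<star> = e"
  by (rule s_inv_eqI) auto

text \<open>Let x be the inverse of ef. Then fxe is an inverse of ef too, so x = fxe by uniqueness,
  and this makes x idempotent. An idempotent is its own inverse, so ef = x.\<close>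

lemma idem_mult_idem:
  assumes e: "e \<in> carrier S" "e \<otimes> e = e" and f: "f \<in> carrier S" "f \<otimes> f = f"
  shows "(e \<otimes> f) \<otimes> (e \<otimes> f) = e \<otimes> f"
proof -
  define x where "x = (e \<otimes> f)\<^sup>\<star>"
  have ef: "e \<otimes> f \<in> carrier S" and x: "x \<in> carrier S"
    using e f by (auto simp: m_closed x_def)
  have ee: "e \<otimes> (e \<otimes> z) = e \<otimes> z" and ff: "f \<otimes> (f \<otimes> z) = f \<otimes> z" if "z \<in> carrier S" for z
    using that e f by (auto simp: m_assoc[symmetric])
  have 1: "e \<otimes> (f \<otimes> (x \<otimes> (e \<otimes> f))) = e \<otimes> f"
    using mult_s_inv_mult(1)[OF ef] e f x by (simp add: m_assoc m_closed x_def[symmetric])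
  have 2: "x \<otimes> (e \<otimes> (f \<otimes> x)) = x"
    using mult_s_inv_mult(2)[OF ef] e f x by (simp add: m_assoc m_closed x_def[symmetric])
  have 3: "x \<otimes> (e \<otimes> (f \<otimes> (x \<otimes> z))) = x \<otimes> z" if "z \<in> carrier S" for z
  proof -
    have "x \<otimes> (e \<otimes> (f \<otimes> (x \<otimes> z))) = (x \<otimes> (e \<otimes> (f \<otimes> x))) \<otimes> z"
      using that e f x by (simp add: m_assoc m_closed)
    then show ?thesis using 2 by simp
  qed
  have xfe: "x = f \<otimes> x \<otimes> e"
    unfolding x_def[symmetric] by (subst x_def, rule s_inv_eqI)
      (use e f x 1 3 in \<open>auto simp: m_assoc m_closed ee ff\<close>)
  have "x \<otimes> x = f \<otimes> x \<otimes> e \<otimes> (f \<otimes> x \<otimes> e)" using xfe by simp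
  also have "\<dots> = f \<otimes> x \<otimes> e" using e f x by (simp add: m_assoc m_closed 3)
  finally have "x \<otimes> x = x" using xfe by simp
  then have "x\<^sup>\<star> = x" by (rule s_inv_idem[OF x])
  then have "e \<otimes> f = x" using ef by (simp add: x_def)
  then show ?thesis using \<open>x \<otimes> x = x\<close> by simp
qed

text \<open>As ef and fe are idempotent, both are inverses of ef, and inverses are unique.\<close>

lemma idem_commute:
  assumes e: "e \<in> carrier S" "e \<otimes> e = e" and f: "f \<in> carrier S" "f \<otimes> f = f"
  shows "e \<otimes> f = f \<otimes> e"
proof -
  have ee: "e \<otimes> (e \<otimes> z) = e \<otimes> z" and ff: "f \<otimes> (f \<otimes> z) = f \<otimes> z" if "z \<in> carrier S" for z
    using that e f by (auto simp: m_assoc[symmetric])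
  have "(e \<otimes> f)\<^sup>\<star> = f \<otimes> e"
    by (rule s_inv_eqI)
      (use e f idem_mult_idem[OF e f] idem_mult_idem[OF f e]
        in \<open>auto simp: m_assoc m_closed ee ff\<close>)
  moreover have "(e \<otimes> f)\<^sup>\<star> = e \<otimes> f"
    by (rule s_inv_idem) (use e f idem_mult_idem[OF e f] in \<open>auto simp: m_closed\<close>)
  ultimately show ?thesis by simp
qed

lemma idem_mult_s_inv:
  assumes "x \<in> carrier S"
  shows "(x \<otimes> x\<^sup>\<star>) \<otimes> (x \<otimes> x\<^sup>\<star>) = x \<otimes> x\<^sup>\<star>" "(x\<^sup>\<star> \<otimes> x) \<otimes> (x\<^sup>\<star> \<otimes> x) = x\<^sup>\<star> \<otimes> x"
  using assms by (simp_all add: m_assoc m_closed mult_s_inv_mult)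

text \<open>The idempotents x^-1 x and y y^-1 meet in the middle of the product; after commuting
  them, each cancels against its neighbour.\<close>

lemma s_inv_mult:
  assumes x: "x \<in> carrier S" and y: "y \<in> carrier S"
  shows "(x \<otimes> y)\<^sup>\<star> = y\<^sup>\<star> \<otimes> x\<^sup>\<star>"
proof (rule s_inv_eqI)
  have c: "(x\<^sup>\<star> \<otimes> x) \<otimes> (y \<otimes> y\<^sup>\<star>) = (y \<otimes> y\<^sup>\<star>) \<otimes> (x\<^sup>\<star> \<otimes> x)"
    using x y by (intro idem_commute) (auto simp: m_closed idem_mult_s_inv)
  have "x \<otimes> y \<otimes> (y\<^sup>\<star> \<otimes> x\<^sup>\<star>) \<otimes> (x \<otimes> y) = x \<otimes> ((y \<otimes> y\<^sup>\<star>) \<otimes> (x\<^sup>\<star> \<otimes> x)) \<otimes> y"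
    using x y by (simp add: m_assoc m_closed)
  also have "\<dots> = x \<otimes> y"
    unfolding c[symmetric] using x y by (simp add: m_assoc m_closed mult_s_inv_mult mult_s_inv_mult_assoc)
  finally show "x \<otimes> y \<otimes> (y\<^sup>\<star> \<otimes> x\<^sup>\<star>) \<otimes> (x \<otimes> y) = x \<otimes> y" .
  have "y\<^sup>\<star> \<otimes> x\<^sup>\<star> \<otimes> (x \<otimes> y) \<otimes> (y\<^sup>\<star> \<otimes> x\<^sup>\<star>) = y\<^sup>\<star> \<otimes> ((x\<^sup>\<star> \<otimes> x) \<otimes> (y \<otimes> y\<^sup>\<star>)) \<otimes> x\<^sup>\<star>"
    using x y by (simp add: m_assoc m_closed)
  also have "\<dots> = y\<^sup>\<star> \<otimes> x\<^sup>\<star>"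
    unfolding c using x y by (simp add: m_assoc m_closed mult_s_inv_mult mult_s_inv_mult_assoc)
  finally show "y\<^sup>\<star> \<otimes> x\<^sup>\<star> \<otimes> (x \<otimes> y) \<otimes> (y\<^sup>\<star> \<otimes> x\<^sup>\<star>) = y\<^sup>\<star> \<otimes> x\<^sup>\<star>" .
qed (use x y in \<open>auto simp: m_closed\<close>)

lemma s_inv_spow: "x \<in> carrier S \<Longrightarrow> (spow S x n)\<^sup>\<star> = spow S (x\<^sup>\<star>) n"
proof (induction n)
  case (Suc n)
  then have "(spow S x (Suc n))\<^sup>\<star> = spow S (x\<^sup>\<star>) n \<otimes> x\<^sup>\<star>"
    by (simp add: s_inv_mult)
  then show ?case using Suc.prems by (metis s_inv_closed spow_Suc_right)
qed simp

lemma inj_spow_s_inv: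
  assumes "x \<in> carrier S" "inj (spow S x)"
  shows "inj (spow S (x\<^sup>\<star>))"
proof (rule injI)
  fix m n assume "spow S (x\<^sup>\<star>) m = spow S (x\<^sup>\<star>) n"
  then have "(spow S x m)\<^sup>\<star>\<^sup>\<star> = (spow S x n)\<^sup>\<star>\<^sup>\<star>" using assms by (simp add: s_inv_spow)
  then show "m = n" using assms by (simp add: inj_eq)
qed

text \<open>The inverse is the only solution of two multiplicative equations, and
  \<open>\<psi>\<close> preserves these.\<close>

lemma iso_s_inv:
  assumes "\<psi> \<in> iso S S" "x \<in> carrier S"
  shows "\<psi> (x\<^sup>\<star>) = (\<psi> x)\<^sup>\<star>"
proof -
  have hom: "\<psi> \<in> hom S S" using assms by (auto simp: iso_def)
  then have cl: "\<psi> y \<in> carrier S" if "y \<in> carrier S" for y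
    using that by (auto simp: hom_def)
  have "\<psi> x \<otimes> \<psi> (x\<^sup>\<star>) \<otimes> \<psi> x = \<psi> (x \<otimes> x\<^sup>\<star> \<otimes> x)"
    "\<psi> (x\<^sup>\<star>) \<otimes> \<psi> x \<otimes> \<psi> (x\<^sup>\<star>) = \<psi> (x\<^sup>\<star> \<otimes> x \<otimes> x\<^sup>\<star>)"
    using assms hom by (auto simp: hom_mult m_closed)
  then have "(\<psi> x)\<^sup>\<star> = \<psi> (x\<^sup>\<star>)"
    by (intro s_inv_eqI) (use assms cl in \<open>auto simp: m_assoc mult_s_inv_mult\<close>)
  then show ?thesis ..
qed

end

section \<open>Finiteness of the inverse subsemigroup generated by an element with a repeated
  power\<close>

text \<open>The words \<open>b\<^sup>i a\<^sup>j\<^sup>+\<^sup>1 b\<^sup>k\<close> with \<open>b\<close> the inverse of \<open>a\<close> and \<open>i, k \<le> j + 1\<close> exhaust the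
  elements of the inverse subsemigroup generated by \<open>a\<close>.\<close>

definition monogenic_word :: "('a, 'm) monoid_scheme \<Rightarrow> 'a \<Rightarrow> nat \<Rightarrow> nat \<Rightarrow> nat \<Rightarrow> 'a" where
  "monogenic_word S a i j k =
     ((\<otimes>\<^bsub>S\<^esub>) (s_inv S a) ^^ i) (((\<lambda>z. z \<otimes>\<^bsub>S\<^esub> s_inv S a) ^^ k) (spow S a j))"

definition monogenic_words :: "('a, 'm) monoid_scheme \<Rightarrow> 'a \<Rightarrow> 'a set" where
  "monogenic_words S a = {monogenic_word S a i j k | i j k. i \<le> Suc j \<and> k \<le> Suc j}"

context inverse_semigroup
begin

lemma funpow_left_closed:
  "x \<in> carrier S \<Longrightarrow> z \<in> carrier S \<Longrightarrow> ((\<otimes>) x ^^ i) z \<in> carrier S"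
  by (induction i) (auto simp: m_closed)

lemma funpow_right_closed:
  "x \<in> carrier S \<Longrightarrow> z \<in> carrier S \<Longrightarrow> ((\<lambda>z. z \<otimes> x) ^^ i) z \<in> carrier S"
  by (induction i) (auto simp: m_closed)

lemma funpow_right_mult:
  assumes "x \<in> carrier S" "y \<in> carrier S" "z \<in> carrier S"
  shows "((\<lambda>z. z \<otimes> x) ^^ i) (y \<otimes> z) = y \<otimes> ((\<lambda>z. z \<otimes> x) ^^ i) z"
  using assms by (induction i) (auto simp: m_assoc funpow_right_closed)

lemma funpow_left_right:
  assumes "x \<in> carrier S" "y \<in> carrier S" "z \<in> carrier S"
  shows "((\<otimes>) y ^^ k) (((\<lambda>z. z \<otimes> x) ^^ i) z) = ((\<lambda>z. z \<otimes> x) ^^ i) (((\<otimes>) y ^^ k) z)"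
  using assms by (induction k) (auto simp: funpow_right_mult funpow_left_closed)

text \<open>Write b for the inverse of a. For i > 0 split the power of a as a^i q; the bound on i
  leaves q a positive power of a. The idempotents ab and b^i a^i commute, so ab can be moved next to
  q, where it is a left unit.\<close>

lemma mult_funpow_s_inv_spow:
  assumes a: "a \<in> carrier S" and "i \<le> j"
  shows "a \<otimes> ((\<otimes>) (a\<^sup>\<star>) ^^ Suc i) (spow S a j) = ((\<otimes>) (a\<^sup>\<star>) ^^ i) (spow S a j)"
proof (cases i)
  case 0
  then show ?thesis using a by (cases j) (auto simp: mult_s_inv_mult mult_s_inv_mult_assoc)
next
  case (Suc m)
  let ?b = "a\<^sup>\<star>" and ?p = "spow S a m"
  define q where "q = spow S a (j - Suc m)"
  have j: "spow S a j = ?p \<otimes> q"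
    using assms Suc spow_mult[OF a, of m "j - Suc m"] by (simp add: q_def)
  have aq: "a \<otimes> (?b \<otimes> q) = q"
    using a unfolding q_def by (cases "j - Suc m") (auto simp: mult_s_inv_mult mult_s_inv_mult_assoc)
  have cl: "?b \<in> carrier S" "?p \<in> carrier S" "q \<in> carrier S" "spow S ?b m \<in> carrier S"
    using a by (auto simp: q_def)
  have c: "(a \<otimes> ?b) \<otimes> (spow S ?b m \<otimes> ?p) = (spow S ?b m \<otimes> ?p) \<otimes> (a \<otimes> ?b)"
    using a idem_mult_s_inv(1)[of a] idem_mult_s_inv(2)[of ?p]
    by (intro idem_commute) (auto simp: m_closed s_inv_spow)
  have "a \<otimes> ((\<otimes>) ?b ^^ Suc i) (spow S a j) = (a \<otimes> ?b) \<otimes> (spow S ?b m \<otimes> ?p) \<otimes> q"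
    using a cl unfolding Suc funpow_mult_left[OF cl(1) spow_closed[OF a]] unfolding j
    by (simp add: m_assoc m_closed)
  also have "\<dots> = spow S ?b m \<otimes> (?p \<otimes> (a \<otimes> (?b \<otimes> q)))"
    unfolding c using a cl by (simp add: m_assoc m_closed)
  also have "\<dots> = ((\<otimes>) ?b ^^ i) (spow S a j)"
    unfolding Suc funpow_mult_left[OF cl(1) spow_closed[OF a]] unfolding j aq ..
  finally show ?thesis .
qed

text \<open>The new letter lengthens the middle block if i = 0, and otherwise cancels one leading
  inverse by \<open>mult_funpow_s_inv_spow\<close>. The trailing block does not interfere, since
  left and right translations commute.\<close>

lemma monogenic_words_mult_left:
  assumes a: "a \<in> carrier S" and w: "w \<in> monogenic_words S a"
  shows "a \<otimes> w \<in> monogenic_words S a"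
proof -
  obtain i j k where ijk: "w = monogenic_word S a i j k" "i \<le> Suc j" "k \<le> Suc j"
    using w by (auto simp: monogenic_words_def)
  show ?thesis
  proof (cases i)
    case 0
    then have "a \<otimes> w = monogenic_word S a 0 (Suc j) k"
      using ijk a by (simp add: monogenic_word_def funpow_right_mult)
    then show ?thesis using ijk by (fastforce simp: monogenic_words_def)
  next
    case (Suc m)
    have "a \<otimes> w = ((\<lambda>z. z \<otimes> a\<^sup>\<star>) ^^ k) (a \<otimes> ((\<otimes>) (a\<^sup>\<star>) ^^ Suc m) (spow S a j))"
      using ijk a Suc unfolding monogenic_word_def
      by (simp only: funpow_left_right s_inv_closed spow_closed funpow_right_mult funpow_left_closed)
    also have "\<dots> = monogenic_word S a m j k"
      using mult_funpow_s_inv_spow[OF a, of m j] ijk Suc a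
      by (simp add: monogenic_word_def funpow_left_right)
    finally show ?thesis using ijk Suc by (fastforce simp: monogenic_words_def)
  qed
qed

text \<open>Only i = j + 1, the largest length allowed for the leading block, needs work. With n = j
  + 1 and b the inverse of a, b b^n a^n = b (ab)(b^n a^n) = b (b^n a^n)(ab) = b^(n+1) a^(n+1) b, so
  all three blocks grow by one letter and the bounds still hold.\<close>

lemma monogenic_words_s_inv_mult_left:
  assumes a: "a \<in> carrier S" and w: "w \<in> monogenic_words S a"
  shows "a\<^sup>\<star> \<otimes> w \<in> monogenic_words S a"
proof -
  obtain i j k where ijk: "w = monogenic_word S a i j k" "i \<le> Suc j" "k \<le> Suc j"
    using w by (auto simp: monogenic_words_def)
  show ?thesis
  proof (cases "i \<le> j")
    case True
    moreover have "a\<^sup>\<star> \<otimes> w = monogenic_word S a (Suc i) j k"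
      using ijk by (simp add: monogenic_word_def)
    ultimately show ?thesis using ijk by (fastforce simp: monogenic_words_def)
  next
    case False
    then have i: "i = Suc j" using ijk by simp
    let ?b = "a\<^sup>\<star>" and ?p = "spow S a j"
    have cl: "?b \<in> carrier S" "?p \<in> carrier S" "spow S ?b j \<in> carrier S" using a by auto
    have c: "(a \<otimes> ?b) \<otimes> (spow S ?b j \<otimes> ?p) = (spow S ?b j \<otimes> ?p) \<otimes> (a \<otimes> ?b)"
      using a idem_mult_s_inv(1)[of a] idem_mult_s_inv(2)[of ?p]
      by (intro idem_commute) (auto simp: m_closed s_inv_spow)
    have "?b \<otimes> (spow S ?b j \<otimes> ?p) = ?b \<otimes> ((a \<otimes> ?b) \<otimes> (spow S ?b j \<otimes> ?p))"
      using a cl by (simp add: m_assoc m_closed mult_s_inv_mult_assoc)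
    also have "\<dots> = spow S ?b (Suc j) \<otimes> (?p \<otimes> a) \<otimes> ?b"
      unfolding c using a cl by (simp add: m_assoc m_closed)
    also have "?p \<otimes> a = spow S a (Suc j)"
      using a by (simp only: spow_Suc_right)
    finally have shift: "?b \<otimes> ((\<otimes>) ?b ^^ Suc j) ?p = ((\<otimes>) ?b ^^ Suc (Suc j)) (spow S a (Suc j)) \<otimes> ?b"
      unfolding funpow_mult_left[OF cl(1) cl(2)] funpow_mult_left[OF cl(1) spow_closed[OF a]] .
    have "?b \<otimes> w = ((\<lambda>z. z \<otimes> ?b) ^^ k) (?b \<otimes> ((\<otimes>) ?b ^^ Suc j) ?p)"
      using ijk a i unfolding monogenic_word_def
      by (simp only: funpow_left_right s_inv_closed spow_closed funpow_right_mult funpow_left_closed)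
    also have "\<dots> = ((\<lambda>z. z \<otimes> ?b) ^^ Suc k) (((\<otimes>) ?b ^^ Suc (Suc j)) (spow S a (Suc j)))"
      unfolding shift by (simp only: funpow_Suc_right o_apply)
    also have "\<dots> = monogenic_word S a (Suc (Suc j)) (Suc j) (Suc k)"
      using a unfolding monogenic_word_def
      by (simp only: funpow_left_right s_inv_closed spow_closed)
    finally show ?thesis using ijk by (fastforce simp: monogenic_words_def)
  qed
qed

text \<open>Multiplying two general words is avoided: it suffices that the generators act on the
  words from the left. Carrying x and its inverse together through the induction turns the inversion
  case into a swap.\<close>

lemma gen_inverse_subsemigroup_subset_monogenic_words:
  assumes a: "a \<in> carrier S"
  shows "gen_inverse_subsemigroup S {a} \<subseteq> monogenic_words S a"
proof
  let ?W = "monogenic_words S a"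
  \<comment> \<open>The words whose left translation preserves the set of words; by associativity
    they are closed under products.\<close>
  let ?L = "{x \<in> carrier S. x \<in> ?W \<and> (\<forall>w \<in> ?W. x \<otimes> w \<in> ?W)}"
  have "a = monogenic_word S a 0 0 0" "a\<^sup>\<star> = monogenic_word S a 1 0 1"
    using a by (auto simp: monogenic_word_def mult_s_inv_mult)
  then have aW: "a \<in> ?W" "a\<^sup>\<star> \<in> ?W" unfolding monogenic_words_def by fastforce+
  have W: "?W \<subseteq> carrier S"
    using a by (auto simp: monogenic_words_def monogenic_word_def
      intro!: funpow_left_closed funpow_right_closed)
  have L_mult: "x \<otimes> y \<in> ?L" if "x \<in> ?L" "y \<in> ?L" for x y
    using that W by (auto simp: m_closed m_assoc subset_iff)
  fix x assume "x \<in> gen_inverse_subsemigroup S {a}"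
  then have "x \<in> ?L \<and> x\<^sup>\<star> \<in> ?L"
  proof induction
    case (incl x)
    then show ?case
      using a aW monogenic_words_mult_left monogenic_words_s_inv_mult_left by auto
  next
    case (mult x y)
    then have "x \<in> carrier S" "y \<in> carrier S" by auto
    then have eq: "(x \<otimes> y)\<^sup>\<star> = y\<^sup>\<star> \<otimes> x\<^sup>\<star>" by (rule s_inv_mult)
    show ?case unfolding eq using mult.IH by (intro conjI L_mult) (elim conjE, assumption)+
  next
    case (inv x)
    then show ?case by auto
  qed
  then show "x \<in> ?W" by blast
qed

text \<open>With A and B the sets of powers of a and of its inverse, both finite here, every word
  lies in A, AB, BA or BAB, according to which outer blocks are empty.\<close>

lemma finite_order_if_not_inj_spow:
  assumes a: "a \<in> carrier S" and ninj: "\<not> inj (spow S a)"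
  shows "finite_order S a"
proof -
  let ?b = "a\<^sup>\<star>"
  let ?A = "range (spow S a)" and ?B = "range (spow S ?b)"
  let ?C = "?A \<union> case_prod (\<otimes>) ` (?A \<times> ?B)"
  let ?D = "?C \<union> case_prod (\<otimes>) ` (?B \<times> ?C)"
  have "\<not> inj (spow S ?b)" using inj_spow_s_inv[of ?b] a ninj by auto
  then have fin: "finite ?A" "finite ?B"
    using a ninj by (auto intro: finite_range_spow)
  have "monogenic_word S a i j k \<in> ?D" for i j k
  proof -
    have cl: "?b \<in> carrier S" using a by simp
    define z where "z = ((\<lambda>z. z \<otimes> ?b) ^^ k) (spow S a j)"
    have z: "z \<in> ?C"
    proof (cases k)
      case 0
      then show ?thesis by (simp add: z_def)
    next
      case (Suc m)
      then have "z = spow S a j \<otimes> spow S ?b m"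
        unfolding z_def using a by (simp only: funpow_mult_right s_inv_closed spow_closed)
      then show ?thesis by force
    qed
    have zc: "z \<in> carrier S" using a by (simp add: z_def funpow_right_closed)
    have "monogenic_word S a i j k = ((\<otimes>) ?b ^^ i) z"
      by (simp add: monogenic_word_def z_def)
    moreover have "((\<otimes>) ?b ^^ i) z \<in> ?D"
    proof (cases i)
      case 0
      then show ?thesis using z by simp
    next
      case (Suc m)
      then have "((\<otimes>) ?b ^^ i) z = case_prod (\<otimes>) (spow S ?b m, z)"
        using cl zc by (simp only: funpow_mult_left prod.case)
      moreover have "(spow S ?b m, z) \<in> ?B \<times> ?C" using z by blast
      ultimately show ?thesis by (metis (no_types, lifting) UnI2 imageI)
    qed
    ultimately show ?thesis by simp
  qed
  then have "monogenic_words S a \<subseteq> ?D" by (auto simp only: monogenic_words_def)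
  moreover have "finite ?D" using fin by simp
  ultimately show ?thesis
    unfolding finite_order_def
    using gen_inverse_subsemigroup_subset_monogenic_words[OF a] by (meson finite_subset)
qed

end

section \<open>Automorphisms obtained from pairs of generators\<close>

text \<open>A map given on generators is treated as a subsemigroup of the direct square. Its
  projections serve as domain and range of the induced isomorphism.\<close>

lemma gen_subsemigroup_DirProd:
  shows "fst ` gen_subsemigroup (S \<times>\<times> S) P = gen_subsemigroup S (fst ` P)"
    and "snd ` gen_subsemigroup (S \<times>\<times> S) P = gen_subsemigroup S (snd ` P)"
proof -
  let ?R = "gen_subsemigroup (S \<times>\<times> S) P"
  have m: "(x \<otimes>\<^bsub>S\<^esub> x', y \<otimes>\<^bsub>S\<^esub> y') \<in> ?R" if "(x, y) \<in> ?R" "(x', y') \<in> ?R" for x y x' y'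
    using gen_subsemigroup.mult[OF that] by (simp add: DirProd_def)
  have le: "fst z \<in> gen_subsemigroup S (fst ` P) \<and> snd z \<in> gen_subsemigroup S (snd ` P)"
    if "z \<in> ?R" for z
    using that
    by induction (auto simp: DirProd_def split: prod.splits intro: gen_subsemigroup.intros)
  have "\<exists>y. (x, y) \<in> ?R" if "x \<in> gen_subsemigroup S (fst ` P)" for x
    using that
  proof induction
    case (incl x)
    then show ?case by (force intro: gen_subsemigroup.incl)
  next
    case (mult x y)
    then show ?case by (blast dest: m)
  qed
  moreover have "\<exists>x. (x, y) \<in> ?R" if "y \<in> gen_subsemigroup S (snd ` P)" for y
    using that
  proof induction
    case (incl x)
    then show ?case by (force intro: gen_subsemigroup.incl)
  next
    case (mult x y)
    then show ?case by (blast dest: m)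
  qed
  ultimately show "fst ` ?R = gen_subsemigroup S (fst ` P)" "snd ` ?R = gen_subsemigroup S (snd ` P)"
    using le by force+
qed

context homogeneous_semigroup
begin

text \<open>The relation generated by \<open>P\<close> is closed under componentwise products. The
  assumption \<open>inj\<close> makes it the graph of a bijection, hence of an isomorphism between
  finitely generated subsemigroups, and homogeneity extends that.\<close>

lemma automorphism_extending_pairs:
  assumes P: "finite P" "P \<noteq> {}" "P \<subseteq> carrier S \<times> carrier S"
    and inj: "\<And>x y x' y'. \<lbrakk>(x, y) \<in> gen_subsemigroup (S \<times>\<times> S) P;
        (x', y') \<in> gen_subsemigroup (S \<times>\<times> S) P\<rbrakk> \<Longrightarrow> x = x' \<longleftrightarrow> y = y'"
  obtains \<psi> where "\<psi> \<in> iso S S" "\<And>x y. (x, y) \<in> P \<Longrightarrow> \<psi> x = y"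
proof -
  let ?R = "gen_subsemigroup (S \<times>\<times> S) P"
  let ?T = "gen_subsemigroup S (fst ` P)" and ?U = "gen_subsemigroup S (snd ` P)"
  have fg: "fg_subsemigroup S ?T" "fg_subsemigroup S ?U"
    unfolding fg_subsemigroup_def using P by (force intro: exI[of _ "fst ` P"] exI[of _ "snd ` P"])+
  define \<phi> where "\<phi> x = (THE y. (x, y) \<in> ?R)" for x
  have \<phi>: "\<phi> x = y" if "(x, y) \<in> ?R" for x y
    unfolding \<phi>_def using that inj by blast
  have T: "\<exists>y. (x, y) \<in> ?R" if "x \<in> ?T" for x
    using that gen_subsemigroup_DirProd(1)[where P = P] by force
  have U: "\<exists>x. (x, y) \<in> ?R" if "y \<in> ?U" for y
    using that gen_subsemigroup_DirProd(2)[where P = P] by force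
  have TU: "x \<in> ?T" "y \<in> ?U" if "(x, y) \<in> ?R" for x y
    using that gen_subsemigroup_DirProd[where P = P] by force+
  have m: "(x \<otimes> x', y \<otimes> y') \<in> ?R" if "(x, y) \<in> ?R" "(x', y') \<in> ?R" for x y x' y'
    using gen_subsemigroup.mult[OF that] by (simp add: DirProd_def)
  have "\<phi> \<in> hom (S\<lparr>carrier := ?T\<rparr>) (S\<lparr>carrier := ?U\<rparr>)"
  proof (rule homI)
    fix x assume "x \<in> carrier (S\<lparr>carrier := ?T\<rparr>)"
    then obtain y where "(x, y) \<in> ?R" using T by auto
    then show "\<phi> x \<in> carrier (S\<lparr>carrier := ?U\<rparr>)" using \<phi> TU by auto
  next
    fix x x' assume "x \<in> carrier (S\<lparr>carrier := ?T\<rparr>)" "x' \<in> carrier (S\<lparr>carrier := ?T\<rparr>)"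
    then obtain y y' where "(x, y) \<in> ?R" "(x', y') \<in> ?R" using T[of x] T[of x'] by auto
    then show "\<phi> (x \<otimes>\<^bsub>S\<lparr>carrier := ?T\<rparr>\<^esub> x') = \<phi> x \<otimes>\<^bsub>S\<lparr>carrier := ?U\<rparr>\<^esub> \<phi> x'"
      using m \<phi> by simp
  qed
  moreover have "bij_betw \<phi> ?T ?U"
  proof (rule bij_betwI')
    fix x x' assume "x \<in> ?T" "x' \<in> ?T"
    then obtain y y' where "(x, y) \<in> ?R" "(x', y') \<in> ?R" using T[of x] T[of x'] by auto
    then show "\<phi> x = \<phi> x' \<longleftrightarrow> x = x'" using inj \<phi> by metis
  next
    fix x assume "x \<in> ?T"
    then show "\<phi> x \<in> ?U" using T \<phi> TU by metis
  next
    fix y assume "y \<in> ?U"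
    then show "\<exists>x \<in> ?T. y = \<phi> x" using U \<phi> TU by metis
  qed
  ultimately have "\<phi> \<in> iso (S\<lparr>carrier := ?T\<rparr>) (S\<lparr>carrier := ?U\<rparr>)" by (simp add: iso_def)
  from extend_iso[OF fg this] obtain \<psi> where \<psi>: "\<psi> \<in> iso S S" "\<forall>x \<in> ?T. \<psi> x = \<phi> x" by blast
  have "\<psi> x = y" if "(x, y) \<in> P" for x y
    using that \<psi> \<phi> TU gen_subsemigroup.incl[of "(x, y)" P] by metis
  with \<psi> show thesis using that by blast
qed

text \<open>A pair of idempotents generates only itself.\<close>

lemma automorphism_idem:
  assumes "e \<in> carrier S" "e \<otimes> e = e" "f \<in> carrier S" "f \<otimes> f = f"
  obtains \<psi> where "\<psi> \<in> iso S S" "\<psi> e = f"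
proof -
  have gen: "z = (e, f)" if "z \<in> gen_subsemigroup (S \<times>\<times> S) {(e, f)}" for z
    using that by induction (use assms in \<open>auto simp: DirProd_def\<close>)
  show thesis
  proof (rule automorphism_extending_pairs[of "{(e, f)}"])
    show "x = x' \<longleftrightarrow> y = y'" if "(x, y) \<in> gen_subsemigroup (S \<times>\<times> S) {(e, f)}"
      "(x', y') \<in> gen_subsemigroup (S \<times>\<times> S) {(e, f)}" for x y x' y'
      using gen[OF that(1)] gen[OF that(2)] by simp
  qed (use assms that in auto)
qed

text \<open>Since g and h are left units for all powers of a, the pairs (g, h) and (a, a) generate
  only the three shapes in \<open>forms\<close>. The only possible coincidences between different
  shapes are a^n g = a^n and a^n h = a^n, and \<open>gh\<close> makes these simultaneous.\<close>

lemma automorphism_left_units: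
  assumes a: "a \<in> carrier S" "inj (spow S a)"
    and g: "g \<in> carrier S" "g \<otimes> g = g" "g \<otimes> a = a"
    and h: "h \<in> carrier S" "h \<otimes> h = h" "h \<otimes> a = a"
    and gh: "\<And>n. spow S a n \<otimes> g = spow S a n \<longleftrightarrow> spow S a n \<otimes> h = spow S a n"
  obtains \<psi> where "\<psi> \<in> iso S S" "\<psi> a = a" "\<psi> g = h"
proof -
  let ?p = "spow S a" and ?P = "{(g, h), (a, a)}"
  have ga: "g \<otimes> ?p n = ?p n" and ha: "h \<otimes> ?p n = ?p n" for n
    using a g h left_unit_spow by auto
  have ga': "g \<otimes> (?p n \<otimes> z) = ?p n \<otimes> z" and ha': "h \<otimes> (?p n \<otimes> z) = ?p n \<otimes> z"
    if "z \<in> carrier S" for n z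
    using a g h that ga ha by (auto simp: m_assoc[symmetric])
  have pp: "?p m \<otimes> (?p n \<otimes> z) = ?p (Suc (m + n)) \<otimes> z" if "z \<in> carrier S" for m n z
    using a that by (simp add: spow_mult m_assoc[symmetric] del: spow.simps(2))
  have forms: "z = (g, h) \<or> (\<exists>n. z = (?p n, ?p n)) \<or> (\<exists>n. z = (?p n \<otimes> g, ?p n \<otimes> h))"
    if "z \<in> gen_subsemigroup (S \<times>\<times> S) ?P" for z
    using that
  proof induction
    case (incl z)
    then show ?case by (metis insertE singletonD spow.simps(1))
  next
    case (mult x y)
    from mult.IH show ?case
      using a g h
      by (elim disjE exE)
        (simp_all add: DirProd_def m_assoc ga ha ga' ha' pp spow_mult m_closed del: spow.simps(2), blast+)
  qed
  define Q where "Q n \<longleftrightarrow> ?p n \<otimes> g = ?p n" for n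
  have cancel: "m = n"
    if "?p m \<otimes> a = ?p n \<otimes> a" for m n
  proof -
    have "?p (Suc m) = ?p (Suc n)" using that a by (simp only: spow_Suc_right)
    then show ?thesis using injD[OF a(2)] by blast
  qed
  \<comment> \<open>Here u is g or h. Multiplying on the right by a removes a factor u, as ua = a,
    and leaves an equation between powers of a; if a^n were u itself, it would be idempotent against
    injectivity.\<close>
  have unit: "?p n \<noteq> u" "?p n \<otimes> u \<noteq> u" "?p n \<otimes> u = ?p m \<Longrightarrow> n = m"
    "?p n \<otimes> u = ?p m \<otimes> u \<Longrightarrow> n = m"
    if u: "u \<in> carrier S" "u \<otimes> u = u" "u \<otimes> a = a" for u m n
  proof -
    have pua: "?p n \<otimes> u \<otimes> a = ?p n \<otimes> a" for n using a u by (simp add: m_assoc)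
    show "?p n \<noteq> u"
    proof
      assume "?p n = u"
      then have "?p (Suc (n + n)) = ?p n" using u a by (metis spow_mult)
      then show False using injD[OF a(2)] by fastforce
    qed
    show "?p n \<otimes> u \<noteq> u"
    proof
      assume "?p n \<otimes> u = u"
      then have "?p n \<otimes> a = ?p 0" using pua[of n] u by simp
      then have "?p (Suc n) = ?p 0" using a by (simp only: spow_Suc_right)
      then show False using injD[OF a(2)] by blast
    qed
    show "n = m" if "?p n \<otimes> u = ?p m" using that pua cancel by metis
    show "n = m" if "?p n \<otimes> u = ?p m \<otimes> u" using that pua cancel by metis
  qed
  have Qg: "?p n \<otimes> g = ?p m \<longleftrightarrow> n = m \<and> Q n" for m n
    using unit(3)[OF g, of n m] by (auto simp: Q_def)
  have Qh: "?p n \<otimes> h = ?p m \<longleftrightarrow> n = m \<and> Q n" for m n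
    using unit(3)[OF h, of n m] by (auto simp: Q_def gh)
  have pow_eq: "?p n = ?p m \<longleftrightarrow> n = m" for m n using a by (simp add: inj_eq)
  have mult_eq: "?p n \<otimes> g = ?p m \<otimes> g \<longleftrightarrow> n = m" "?p n \<otimes> h = ?p m \<otimes> h \<longleftrightarrow> n = m" for m n
    using unit(4)[OF g] unit(4)[OF h] by auto
  note ne = unit(1,2)[OF g] unit(1,2)[OF h]
  show thesis
  proof (rule automorphism_extending_pairs[of ?P])
    fix x y x' y'
    assume "(x, y) \<in> gen_subsemigroup (S \<times>\<times> S) ?P" "(x', y') \<in> gen_subsemigroup (S \<times>\<times> S) ?P"
    from forms[OF this(1)] forms[OF this(2)]
    show "x = x' \<longleftrightarrow> y = y'"
      \<comment> \<open>Nine combinations of shapes arise; the rules are supplied in both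
        orientations because either side of an equation may carry the factor g or h.\<close>
      by (elim disjE exE) (simp_all add: ne ne[symmetric] Qg Qh Qg[THEN eq_commute[THEN trans]]
        Qh[THEN eq_commute[THEN trans]] pow_eq mult_eq)
  qed (use a g h that in auto)
qed

end

section \<open>Idempotents in a homogeneous inverse semigroup\<close>

locale homogeneous_inverse_semigroup = inverse_semigroup + homogeneous_semigroup
begin

text \<open>The automorphism from \<open>automorphism_left_units\<close> fixes a, hence also its
  inverse and a a^-1. As it sends g to a a^-1 as well, injectivity identifies the two.\<close>

lemma idem_eq_range_idem:
  assumes a: "a \<in> carrier S" "inj (spow S a)"
    and g: "g \<in> carrier S" "g \<otimes> g = g" "g \<otimes> a = a"
    and eq: "\<And>n. spow S a n \<otimes> g = spow S a n \<longleftrightarrow> spow S a n \<otimes> (a \<otimes> a\<^sup>\<star>) = spow S a n"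
  shows "g = a \<otimes> a\<^sup>\<star>"
proof -
  have e: "a \<otimes> a\<^sup>\<star> \<in> carrier S" "(a \<otimes> a\<^sup>\<star>) \<otimes> (a \<otimes> a\<^sup>\<star>) = a \<otimes> a\<^sup>\<star>" "(a \<otimes> a\<^sup>\<star>) \<otimes> a = a"
    using a by (auto simp: m_closed idem_mult_s_inv m_assoc mult_s_inv_mult)
  obtain \<psi> where \<psi>: "\<psi> \<in> iso S S" "\<psi> a = a" "\<psi> g = a \<otimes> a\<^sup>\<star>"
    using automorphism_left_units[OF a g e eq] by blast
  then have "\<psi> (a \<otimes> a\<^sup>\<star>) = a \<otimes> a\<^sup>\<star>"
    using a iso_s_inv[of \<psi> a] hom_mult[of \<psi> S S a "a\<^sup>\<star>"] by (simp add: iso_def)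
  moreover have "inj_on \<psi> (carrier S)" using \<psi> by (auto simp: iso_def bij_betw_def)
  ultimately show ?thesis using \<psi> g e by (metis inj_onD)
qed

text \<open>Powers of a commute, so the fixed power can be moved next to the innermost a a^-1 and
  absorb it, which lowers j by one. The instance j = n is the one needed later.\<close>

lemma right_unit_power:
  assumes a: "a \<in> carrier S" "spow S a n \<otimes> (a \<otimes> a\<^sup>\<star>) = spow S a n"
  shows "spow S a n \<otimes> (spow S a j \<otimes> (spow S a j)\<^sup>\<star>) = spow S a n"
proof (induction j)
  case (Suc j)
  let ?p = "spow S a" and ?q = "spow S (a\<^sup>\<star>)"
  have cl: "?q k \<in> carrier S" "?p k \<in> carrier S" "a\<^sup>\<star> \<in> carrier S" for k using a by auto
  have "?p n \<otimes> (?p (Suc j) \<otimes> (?p (Suc j))\<^sup>\<star>) = (?p n \<otimes> ?p j) \<otimes> (a \<otimes> a\<^sup>\<star>) \<otimes> ?q j"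
    unfolding s_inv_spow[OF a(1)] unfolding spow_Suc_right[OF a(1)] spow.simps(2)[of S "a\<^sup>\<star>"]
    using a cl by (simp add: m_assoc m_closed)
  also have "?p n \<otimes> ?p j = ?p j \<otimes> ?p n"
    using a by (simp add: spow_mult add.commute del: spow.simps(2))
  also have "?p j \<otimes> ?p n \<otimes> (a \<otimes> a\<^sup>\<star>) = ?p j \<otimes> ?p n"
    using a cl by (simp add: m_assoc[of "?p j"] m_closed del: s_inv_closed)
  also have "?p j \<otimes> ?p n = ?p n \<otimes> ?p j"
    using a by (simp add: spow_mult add.commute del: spow.simps(2))
  also have "?p n \<otimes> ?p j \<otimes> ?q j = ?p n"
    using Suc a cl by (simp add: m_assoc s_inv_spow)
  finally show ?case .
qed (use a in simp)

lemma exists_two_sided_range_unit: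
  assumes a: "a \<in> carrier S" "inj (spow S a)"
  obtains b where "b \<in> carrier S" "inj (spow S b)" "b \<otimes> (b \<otimes> b\<^sup>\<star>) = b"
proof (cases "\<exists>n. spow S a n \<otimes> (a \<otimes> a\<^sup>\<star>) = spow S a n")
  case True
  then obtain n where "spow S a n \<otimes> (a \<otimes> a\<^sup>\<star>) = spow S a n" ..
  then show thesis
    using that[of "spow S a n"] right_unit_power a inj_spow_spow by simp
next
  case False
  let ?p = "spow S a" and ?e = "a \<otimes> a\<^sup>\<star>" and ?f = "a\<^sup>\<star> \<otimes> a"
  \<comment> \<open>From af = a it follows that left multiplication by a turns powers of c into
    powers of a, so those of c are distinct too. Moreover c c^-1 = ef, which makes the criterion for
    c compare e with ef.\<close>
  define c where "c = ?f \<otimes> a"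
  have cl: "a\<^sup>\<star> \<in> carrier S" "?e \<in> carrier S" "?f \<in> carrier S" "c \<in> carrier S" "?p n \<in> carrier S" for n
    using a by (auto simp: m_closed c_def)
  have fe: "?f \<otimes> ?e = ?e \<otimes> ?f"
    using a by (intro idem_commute) (auto simp: m_closed idem_mult_s_inv)
  have e_a: "?e \<otimes> a = a" and a_f: "a \<otimes> ?f = a"
    using a by (auto simp: m_assoc mult_s_inv_mult)
  have c_pow: "spow S c n = ?f \<otimes> ?p n" for n
  proof (induction n)
    case (Suc n)
    have "?f \<otimes> a \<otimes> (?f \<otimes> ?p n) = ?f \<otimes> ((a \<otimes> ?f) \<otimes> ?p n)"
      using a cl by (simp add: m_assoc m_closed)
    then show ?case using Suc a_f by (simp add: c_def)
  qed (simp add: c_def)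
  have a_c_pow: "a \<otimes> spow S c n = ?p (Suc n)" for n
    using a cl a_f by (simp add: c_pow m_assoc[symmetric] del: s_inv_closed)
  have inj_c: "inj (spow S c)"
    using a a_c_pow by (metis injD injI nat.inject)
  have no_unit: "spow S c n \<otimes> ?e \<noteq> spow S c n" for n
  proof
    assume "spow S c n \<otimes> ?e = spow S c n"
    then have "a \<otimes> (spow S c n \<otimes> ?e) = a \<otimes> spow S c n" by simp
    also have "a \<otimes> (spow S c n \<otimes> ?e) = a \<otimes> spow S c n \<otimes> ?e"
      using a cl by (simp only: m_assoc spow_closed)
    finally have "?p (Suc n) \<otimes> ?e = ?p (Suc n)" unfolding a_c_pow .
    then show False using False by blast
  qed
  have "c\<^sup>\<star> = a\<^sup>\<star> \<otimes> ?f"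
    using a cl by (simp add: c_def s_inv_mult)
  then have "c \<otimes> c\<^sup>\<star> = (?f \<otimes> ?e) \<otimes> ?f"
    using a cl by (simp add: c_def m_assoc m_closed)
  also have "\<dots> = ?e \<otimes> (?f \<otimes> ?f)" unfolding fe using cl by (simp only: m_assoc)
  finally have cc: "c \<otimes> c\<^sup>\<star> = ?e \<otimes> ?f" using a by (simp add: idem_mult_s_inv)
  have "?e = c \<otimes> c\<^sup>\<star>"
  proof (rule idem_eq_range_idem)
    show "?e \<otimes> ?e = ?e" using a by (simp add: idem_mult_s_inv)
    have "?e \<otimes> c = (?e \<otimes> ?f) \<otimes> a" using a cl by (simp add: c_def m_assoc m_closed)
    also have "\<dots> = ?f \<otimes> (?e \<otimes> a)" unfolding fe[symmetric] using a cl by (simp add: m_assoc m_closed)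
    finally show "?e \<otimes> c = c" by (simp add: e_a c_def)
    \<comment> \<open>Both sides are false: c c^-1 e = c c^-1, so a power of c that absorbs c c^-1
      also absorbs e, which \<open>no_unit\<close> excludes.\<close>
    show "spow S c n \<otimes> ?e = spow S c n \<longleftrightarrow> spow S c n \<otimes> (c \<otimes> c\<^sup>\<star>) = spow S c n" for n
    proof -
      have "spow S c n \<otimes> (c \<otimes> c\<^sup>\<star>) \<otimes> ?e = spow S c n \<otimes> (?f \<otimes> (?e \<otimes> ?e))"
        unfolding cc fe[symmetric] using cl by (simp add: m_assoc m_closed del: s_inv_closed)
      also have "\<dots> = spow S c n \<otimes> (c \<otimes> c\<^sup>\<star>)"
        unfolding cc fe[symmetric] using a by (simp add: idem_mult_s_inv)
      finally show ?thesis using no_unit[of n] by auto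
    qed
  qed (use cl inj_c in auto)
  \<comment> \<open>Now a^-1 = a^-1 e = a^-1 e f = a^-1 f, and f is the idempotent b b^-1 for b =
    a^-1.\<close>
  then have "?e = ?e \<otimes> ?f" using cc by simp
  then have "a\<^sup>\<star> \<otimes> ?f = a\<^sup>\<star> \<otimes> ?e \<otimes> ?f"
    using a by (simp add: mult_s_inv_mult)
  also have "\<dots> = a\<^sup>\<star> \<otimes> (?e \<otimes> ?f)" using cl by (simp only: m_assoc)
  also have "\<dots> = a\<^sup>\<star>" using \<open>?e = ?e \<otimes> ?f\<close> a by (metis mult_s_inv_mult(2))
  finally show thesis using that[of "a\<^sup>\<star>"] a inj_spow_s_inv by simp
qed

lemma unique_idem:
  assumes b: "b \<in> carrier S" "inj (spow S b)" "b \<otimes> (b \<otimes> b\<^sup>\<star>) = b"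
    and e: "e \<in> carrier S" "e \<otimes> e = e"
  shows "e = b \<otimes> b\<^sup>\<star>"
proof -
  define u where "u = b \<otimes> b\<^sup>\<star>"
  have u: "u \<in> carrier S" "u \<otimes> u = u" "u \<otimes> b = b" "b \<otimes> u = b"
    using b by (auto simp: u_def m_closed idem_mult_s_inv m_assoc mult_s_inv_mult)
  have maximal: "g = u" if g: "g \<in> carrier S" "g \<otimes> g = g" "g \<otimes> u = u" for g
    unfolding u_def
  proof (rule idem_eq_range_idem[OF b(1,2) g(1,2)])
    show "g \<otimes> b = b" using g u b by (metis m_assoc)
    \<comment> \<open>As g commutes with u, it is a right unit for b as well, so both sides of the
      criterion hold for every n.\<close>
    have "u \<otimes> g = u" using idem_commute[OF g(1,2) u(1,2)] g by simp
    then have "b \<otimes> g = b" using g u b by (metis m_assoc)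
    then show "spow S b n \<otimes> g = spow S b n \<longleftrightarrow> spow S b n \<otimes> (b \<otimes> b\<^sup>\<star>) = spow S b n" for n
      using right_unit_spow[OF g(1) b(1)] right_unit_spow[OF u(1) b(1) u(4)] by (simp add: u_def)
  qed
  \<comment> \<open>An arbitrary e need not be comparable with u, but ue lies below both. An
    automorphism taking ue to u takes u to an idempotent above u, so it fixes u by maximality;
    injectivity then gives u = ue, so e lies above u.\<close>
  let ?p = "u \<otimes> e"
  have p: "?p \<in> carrier S" "?p \<otimes> ?p = ?p" "u \<otimes> ?p = ?p"
    using u e idem_mult_idem by (auto simp: m_closed m_assoc[symmetric])
  obtain \<psi> where \<psi>: "\<psi> \<in> iso S S" "\<psi> ?p = u" using automorphism_idem[OF p(1,2) u(1,2)] by blast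
  then have hom: "\<psi> \<in> hom S S" and inj: "inj_on \<psi> (carrier S)" by (auto simp: iso_def bij_betw_def)
  have "\<psi> u = u"
  proof (rule maximal)
    show "\<psi> u \<in> carrier S" using hom u by (auto simp: hom_def)
    show "\<psi> u \<otimes> \<psi> u = \<psi> u" "\<psi> u \<otimes> u = u" using hom u p \<psi> by (metis hom_mult)+
  qed
  then have "u = ?p" using inj \<psi> u p by (metis inj_onD)
  then have "e \<otimes> u = u" using idem_commute[OF e u(1,2)] by simp
  then show ?thesis using maximal[OF e] by (simp add: u_def)
qed

end

section \<open>Choice of the identity and conclusion\<close>

lemma gen_subsemigroup_one_update [simp]:
  "gen_subsemigroup (S\<lparr>one := e\<rparr>) A = gen_subsemigroup S A"
proof (intro equalityI subsetI)
  show "x \<in> gen_subsemigroup S A" if "x \<in> gen_subsemigroup (S\<lparr>one := e\<rparr>) A" for x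
    using that by induction (auto intro: gen_subsemigroup.intros)
  show "x \<in> gen_subsemigroup (S\<lparr>one := e\<rparr>) A" if "x \<in> gen_subsemigroup S A" for x
    using that
  proof induction
    case (mult x y)
    then show ?case using gen_subsemigroup.mult[of x "S\<lparr>one := e\<rparr>" A y] by simp
  qed (rule gen_subsemigroup.incl)
qed

text \<open>Generated subsemigroups and isomorphisms depend on \<open>carrier\<close> and
  \<open>mult\<close> alone, so homogeneity survives the choice of \<open>one\<close> that
  \<open>group\<close> calls for.\<close>

lemma homogeneous_semigroup_one_update:
  assumes "homogeneous_semigroup S"
  shows "homogeneous_semigroup (S\<lparr>one := e\<rparr>)"
proof -
  interpret homogeneous_semigroup S by fact
  show ?thesis
  proof
    fix T U \<phi>
    assume "fg_subsemigroup (S\<lparr>one := e\<rparr>) T" "fg_subsemigroup (S\<lparr>one := e\<rparr>) U"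
      "\<phi> \<in> iso (S\<lparr>one := e, carrier := T\<rparr>) (S\<lparr>one := e, carrier := U\<rparr>)"
    then have "\<exists>\<psi> \<in> iso S S. \<forall>x \<in> T. \<psi> x = \<phi> x"
      by (intro extend_iso[of T U \<phi>]) (simp_all add: fg_subsemigroup_def iso_def hom_def)
    then show "\<exists>\<psi> \<in> iso (S\<lparr>one := e\<rparr>) (S\<lparr>one := e\<rparr>). \<forall>x \<in> T. \<psi> x = \<phi> x"
      by (auto simp: iso_def hom_def)
  qed (auto simp: m_closed m_assoc)
qed

theorem corollary6p4:
  fixes S :: "('a, 'm) monoid_scheme"
  assumes "countable (carrier S)"
    and "inverse_semigroup S"
    and "homogeneous_semigroup S"
    and "\<not> periodic S"
  shows "\<exists>e. group (S\<lparr>one := e\<rparr>) \<and> homogeneous_semigroup (S\<lparr>one := e\<rparr>)"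
proof -
  interpret inverse_semigroup S by fact
  interpret homogeneous_semigroup S by fact
  interpret homogeneous_inverse_semigroup S ..
  \<comment> \<open>An element of infinite order has distinct powers, by the contrapositive of
    \<open>finite_order_if_not_inj_spow\<close>.\<close>
  obtain a where a: "a \<in> carrier S" "inj (spow S a)"
    using assms(4) finite_order_if_not_inj_spow unfolding periodic_def by blast
  obtain b where b: "b \<in> carrier S" "inj (spow S b)" "b \<otimes>\<^bsub>S\<^esub> (b \<otimes>\<^bsub>S\<^esub> s_inv S b) = b"
    using exists_two_sided_range_unit[OF a] by blast
  define e where "e = b \<otimes>\<^bsub>S\<^esub> s_inv S b"
  have e: "e \<in> carrier S" using b by (simp add: e_def m_closed)
  \<comment> \<open>Both products are idempotent, hence equal to the only idempotent e.\<close>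
  have inv: "s_inv S x \<otimes>\<^bsub>S\<^esub> x = e" "x \<otimes>\<^bsub>S\<^esub> s_inv S x = e" if "x \<in> carrier S" for x
    unfolding e_def using that by (auto intro!: unique_idem[OF b] simp: m_closed idem_mult_s_inv)
  have "group (S\<lparr>one := e\<rparr>)"
  proof (rule groupI)
    fix x assume "x \<in> carrier (S\<lparr>one := e\<rparr>)"
    then have x: "x \<in> carrier S" by simp
    \<comment> \<open>Replacing e by x x^-1 turns the unit law into x x^-1 x = x.\<close>
    show "\<one>\<^bsub>S\<lparr>one := e\<rparr>\<^esub> \<otimes>\<^bsub>S\<lparr>one := e\<rparr>\<^esub> x = x"
      using x inv(2)[OF x, symmetric] by (simp add: m_assoc mult_s_inv_mult)
    show "\<exists>y \<in> carrier (S\<lparr>one := e\<rparr>). y \<otimes>\<^bsub>S\<lparr>one := e\<rparr>\<^esub> x = \<one>\<^bsub>S\<lparr>one := e\<rparr>\<^esub>"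
      using x inv(1)[OF x] by auto
  qed (auto simp: e m_closed m_assoc)
  then show ?thesis using homogeneous_semigroup_one_update[OF assms(3)] by blast
qed

end
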